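(* For every connected graph $G$ with $\alpha(G)=3$, $\mathrm{pc}_{\mathrm{opt}}(G)\le 4$.
   Context: All graphs are simple and finite. $\alpha(G)$ denotes the independence number of $G$. An edge-colored graph is properly colored if no two adjacent edges (edges sharing an endpoint) have the same color. An edge-colored connected graph $G$ is properly connected if between every pair of distinct vertices of $G$ there is a properly colored path (the edge-coloring of $G$ itself need not be proper). Optimal proper connection number: let $G$ be a connected graph, and suppose initially all edges of $G$ are colored by color $1$. Then $\mathrm{pc}_{\mathrm{opt}}(G)$ is the minimum of $p+q$ over all nonnegative integers $p,q$ such that, by recoloring $p$ edges of $G$ with $q$ new colors (colors different from $1$), the remaining edges keeping color $1$, one can make $G$ properly connected. (Here $p$ is the number of recolored edges and $q$ is the number of new colors used; $p=q=0$ is allowed.) *)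

theory Defs
  imports Main
begin

text \<open>A finite simple graph is given by a vertex set and a set of edges, where an edge
  is a two-element set of vertices.\<close>

definition fin_simple_graph :: "'a set \<Rightarrow> 'a set set \<Rightarrow> bool" where
  "fin_simple_graph V E \<longleftrightarrow> finite V \<and> (\<forall>e\<in>E. e \<subseteq> V \<and> card e = 2)"

definition indep_set :: "'a set \<Rightarrow> 'a set set \<Rightarrow> 'a set \<Rightarrow> bool" where
  "indep_set V E S \<longleftrightarrow> S \<subseteq> V \<and> (\<forall>x\<in>S. \<forall>y\<in>S. {x, y} \<notin> E)"

definition indep_number :: "'a set \<Rightarrow> 'a set set \<Rightarrow> nat" where
  "indep_number V E = Max (card ` {S. indep_set V E S})"

definition path_edges :: "'a list \<Rightarrow> 'a set set" where
  "path_edges xs = {{xs ! i, xs ! Suc i} | i. Suc i < length xs}"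

definition is_path :: "'a set \<Rightarrow> 'a set set \<Rightarrow> 'a \<Rightarrow> 'a list \<Rightarrow> 'a \<Rightarrow> bool" where
  "is_path V E u xs v \<longleftrightarrow>
     xs \<noteq> [] \<and> hd xs = u \<and> last xs = v \<and> distinct xs \<and> set xs \<subseteq> V \<and> path_edges xs \<subseteq> E"

definition connected_graph :: "'a set \<Rightarrow> 'a set set \<Rightarrow> bool" where
  "connected_graph V E \<longleftrightarrow> V \<noteq> {} \<and> (\<forall>u\<in>V. \<forall>v\<in>V. \<exists>xs. is_path V E u xs v)"

definition properly_colored :: "('a set \<Rightarrow> nat) \<Rightarrow> 'a set set \<Rightarrow> bool" where
  "properly_colored c F \<longleftrightarrow> (\<forall>e\<in>F. \<forall>f\<in>F. e \<noteq> f \<and> e \<inter> f \<noteq> {} \<longrightarrow> c e \<noteq> c f)"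

definition properly_connected :: "'a set \<Rightarrow> 'a set set \<Rightarrow> ('a set \<Rightarrow> nat) \<Rightarrow> bool" where
  "properly_connected V E c \<longleftrightarrow>
     (\<forall>u\<in>V. \<forall>v\<in>V. u \<noteq> v \<longrightarrow>
        (\<exists>xs. is_path V E u xs v \<and> properly_colored c (path_edges xs)))"

text \<open>Colors are natural numbers and the initial color is \<open>1\<close>. The recolored edges are
  those whose final color \<open>c e\<close> differs from \<open>1\<close>.\<close>

definition recolored :: "'a set set \<Rightarrow> ('a set \<Rightarrow> nat) \<Rightarrow> 'a set set" where
  "recolored E c = {e\<in>E. c e \<noteq> 1}"

definition pc_recoloring :: "'a set \<Rightarrow> 'a set set \<Rightarrow> nat \<Rightarrow> nat \<Rightarrow> bool" where
  "pc_recoloring V E p q \<longleftrightarrow>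
     (\<exists>c. card (recolored E c) = p \<and> card (c ` recolored E c) = q \<and> properly_connected V E c)"

definition pc_opt :: "'a set \<Rightarrow> 'a set set \<Rightarrow> nat" where
  "pc_opt V E = (LEAST n. \<exists>p q. n = p + q \<and> pc_recoloring V E p q)"

text \<open>The minimum is attained for every finite connected graph: give pairwise different
  colors to the edges.\<close>

lemma pc_recoloring_exists:
  assumes "fin_simple_graph V E" "connected_graph V E"
  shows "\<exists>p q. pc_recoloring V E p q"
proof -
  have "E \<subseteq> Pow V" "finite V"
    using assms(1) by (auto simp: fin_simple_graph_def)
  then have "finite E"
    by (meson finite_Pow_iff finite_subset)
  then obtain c :: "'a set \<Rightarrow> nat" where c: "inj_on c E"
    using finite_imp_inj_to_nat_seg by metis
  have "properly_connected V E c"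
    unfolding properly_connected_def
  proof (intro ballI impI)
    fix u v assume "u \<in> V" "v \<in> V"
    then obtain xs where xs: "is_path V E u xs v"
      using assms(2) by (auto simp: connected_graph_def)
    then have "path_edges xs \<subseteq> E"
      by (simp add: is_path_def)
    with c have "properly_colored c (path_edges xs)"
      unfolding properly_colored_def by (meson inj_onD subsetD)
    with xs show "\<exists>xs. is_path V E u xs v \<and> properly_colored c (path_edges xs)"
      by blast
  qed
  then show ?thesis
    by (auto simp: pc_recoloring_def)
qed

lemma pc_opt_attained:
  assumes "fin_simple_graph V E" "connected_graph V E"
  shows "\<exists>p q. pc_opt V E = p + q \<and> pc_recoloring V E p q"
proof -
  have "\<exists>n p q. n = p + q \<and> pc_recoloring V E p q"
    using pc_recoloring_exists[OF assms] by blast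
  then show ?thesis
    unfolding pc_opt_def by (rule LeastI_ex)
qed

end

theory Submission
  imports Defs
begin

text \<open>Color the edges of a small connected induced subgraph \<open>H\<close> and leave all other edges in
  color \<open>1\<close>. Since \<open>H\<close> together with two nonadjacent outside vertices contains no independent
  4-set, these two vertices have many neighbors in \<open>H\<close>, which often forces a properly colored
  path through \<open>H\<close>. In this way a counterexample contains, in this order, no induced path or cycle
  on six vertices, no 5-cycle with a pendant edge, no 4-cycle with a pendant path of length two,
  no 4-cycle with a pendant edge (these with one new color), and then no induced \<open>P\<^sub>5\<close>, fork,
  claw and bull (with two new colors on two adjacent edges). But a connected graph without induced
  claw, bull and \<open>P\<^sub>5\<close> has no independent 3-set.\<close>

section \<open>Properly colored paths as lists\<close>

text \<open>Recursive, so that the simplifier can evaluate it on explicit vertex lists. Comparing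
  each edge with its successor is enough because the lists used are distinct.\<close>

fun proper_walk :: "'a set set \<Rightarrow> ('a set \<Rightarrow> nat) \<Rightarrow> 'a list \<Rightarrow> bool" where
  "proper_walk E c [] \<longleftrightarrow> False"
| "proper_walk E c [x] \<longleftrightarrow> True"
| "proper_walk E c [x, y] \<longleftrightarrow> {x, y} \<in> E"
| "proper_walk E c (x # y # z # xs) \<longleftrightarrow>
     {x, y} \<in> E \<and> c {x, y} \<noteq> c {y, z} \<and> proper_walk E c (y # z # xs)"

lemma path_edges_Cons_Cons:
  "path_edges (x # y # xs) = insert {x, y} (path_edges (y # xs))"
proof -
  have "path_edges (x # y # xs) =
      (\<lambda>i. {(x # y # xs) ! i, (x # y # xs) ! Suc i}) ` {i. Suc i < length (x # y # xs)}"
    by (auto simp: path_edges_def)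
  also have "{i. Suc i < length (x # y # xs)} = insert 0 (Suc ` {i. Suc i < length (y # xs)})"
    by (auto simp: image_iff less_Suc_eq_0_disj)
  finally show ?thesis
    by (auto simp: path_edges_def image_iff)
qed

lemma path_edges_single: "path_edges [x] = {}"
  by (simp add: path_edges_def)

lemma path_edges_subset_set: "e \<in> path_edges xs \<Longrightarrow> e \<subseteq> set xs"
  by (auto simp: path_edges_def)

lemma proper_walk_path_edges:
  "proper_walk E c xs \<Longrightarrow> path_edges xs \<subseteq> E"
  by (induction E c xs rule: proper_walk.induct)
     (auto simp: path_edges_Cons_Cons path_edges_single)

text \<open>On distinct vertices, edges that meet are consecutive: the only tail edge meeting
  \<open>{x, y}\<close> is \<open>{y, z}\<close>.\<close>

lemma proper_walk_properly_colored:
  "proper_walk E c xs \<Longrightarrow> distinct xs \<Longrightarrow> properly_colored c (path_edges xs)"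
proof (induction E c xs rule: proper_walk.induct)
  case (4 E c x y z xs)
  have IH: "properly_colored c (path_edges (y # z # xs))"
    using 4 by simp
  have "c f \<noteq> c {x, y}" if f: "f \<in> path_edges (y # z # xs)" "f \<inter> {x, y} \<noteq> {}" for f
  proof -
    have "x \<notin> f"
      using path_edges_subset_set[OF f(1)] 4(3) by auto
    with f(2) have "y \<in> f"
      by auto
    then have "f = {y, z}"
      using f(1) path_edges_subset_set[of f "z # xs"] 4(3)
      by (auto simp: path_edges_Cons_Cons[of y z])
    then show ?thesis
      using 4(2) by simp
  qed
  then show ?case
    using IH unfolding properly_colored_def path_edges_Cons_Cons[of x y]
    by (metis inf_commute insert_iff)
qed (auto simp: path_edges_Cons_Cons path_edges_single properly_colored_def)

definition joined :: "'a set \<Rightarrow> 'a set set \<Rightarrow> ('a set \<Rightarrow> nat) \<Rightarrow> 'a \<Rightarrow> 'a \<Rightarrow> bool" where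
  "joined V E c u v \<longleftrightarrow>
     (\<exists>xs. is_path V E u xs v \<and> properly_colored c (path_edges xs))"

lemma joinedI:
  assumes "proper_walk E c xs" "distinct xs" "set xs \<subseteq> V" "hd xs = u" "last xs = v"
  shows "joined V E c u v"
proof -
  have "xs \<noteq> []"
    using assms(1) by auto
  then show ?thesis
    using assms proper_walk_path_edges[of E c xs] proper_walk_properly_colored[of E c xs]
    unfolding joined_def is_path_def by blast
qed

lemma path_edges_rev: "path_edges (rev xs) = path_edges xs"
proof -
  have "path_edges (rev xs) \<subseteq> path_edges xs" for xs :: "'a list"
  proof
    fix e assume "e \<in> path_edges (rev xs)"
    then obtain i where i: "Suc i < length xs" "e = {rev xs ! i, rev xs ! Suc i}"
      by (auto simp: path_edges_def)
    \<comment> \<open>Reversal moves the edge at index \<open>i\<close> to this index and exchanges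
      its ends.\<close>
    define j where "j = length xs - Suc (Suc i)"
    have j: "Suc j < length xs" "rev xs ! i = xs ! Suc j" "rev xs ! Suc i = xs ! j"
      using i(1) by (auto simp: j_def rev_nth Suc_diff_Suc)
    then have "e = {xs ! j, xs ! Suc j}"
      using i(2) by auto
    with j(1) show "e \<in> path_edges xs"
      by (auto simp: path_edges_def)
  qed
  from this[of xs] this[of "rev xs"] show ?thesis
    by simp
qed

lemma joined_sym: "joined V E c u v \<Longrightarrow> joined V E c v u"
  unfolding joined_def is_path_def
  by (metis distinct_rev hd_rev last_rev path_edges_rev rev_is_Nil_conv set_rev)

lemma proper_walk_take:
  "proper_walk E c xs \<Longrightarrow> 0 < n \<Longrightarrow> proper_walk E c (take n xs)"
proof (induction E c xs arbitrary: n rule: proper_walk.induct)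
  case (3 E c x y)
  then show ?case by (cases n; cases "n - 1") auto
next
  case (4 E c x y z xs)
  then obtain m where n: "n = Suc m"
    by (cases n) auto
  show ?case
  proof (cases m)
    case (Suc k)
    have "proper_walk E c (take m (y # z # xs))"
      using "4.IH"[of m] "4.prems" Suc by simp
    then show ?thesis
      using "4.prems" n Suc by (cases k) auto
  qed (simp add: n)
qed (auto simp: take_Cons split: nat.splits)

lemma joined_prefix:
  assumes "proper_walk E c (u # xs)" "distinct (u # xs)" "set (u # xs) \<subseteq> V" "v \<in> set (u # xs)"
  shows "joined V E c u v"
proof -
  obtain i where i: "i < length (u # xs)" "(u # xs) ! i = v"
    using assms(4) by (metis in_set_conv_nth)
  have "joined V E c (hd (take (Suc i) (u # xs))) (last (take (Suc i) (u # xs)))"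
    using assms set_take_subset[of "Suc i" "u # xs"]
    by (intro joinedI[OF proper_walk_take[OF assms(1)]] distinct_take) auto
  moreover have "last (take (Suc i) (u # xs)) = v"
    using i by (metis last_snoc take_Suc_conv_app_nth)
  ultimately show ?thesis
    by simp
qed

lemma proper_walk_snoc:
  "proper_walk E c xs \<Longrightarrow> {last xs, v} \<in> E \<Longrightarrow> 2 \<le> length xs \<Longrightarrow>
    c {last (butlast xs), last xs} \<noteq> c {last xs, v} \<Longrightarrow> proper_walk E c (xs @ [v])"
  by (induction E c xs rule: proper_walk.induct) auto

lemma proper_walk_Cons_tl:
  "proper_walk E c (x # xs) \<Longrightarrow> xs \<noteq> [] \<Longrightarrow> proper_walk E c xs"
  by (induction E c "x # xs" rule: proper_walk.induct) auto

lemma joined_in_walk: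
  "proper_walk E c xs \<Longrightarrow> distinct xs \<Longrightarrow> set xs \<subseteq> V \<Longrightarrow> u \<in> set xs \<Longrightarrow> v \<in> set xs \<Longrightarrow>
    joined V E c u v"
proof (induction xs)
  case (Cons x xs)
  show ?case
  proof (cases "u = x \<or> v = x")
    case True
    then show ?thesis
      using joined_prefix[of E c x xs V] Cons.prems joined_sym[of V E c x] by blast
  next
    case False
    then have "xs \<noteq> []" "u \<in> set xs" "v \<in> set xs"
      using Cons.prems by auto
    then show ?thesis
      using Cons proper_walk_Cons_tl[of E c x xs] by auto
  qed
qed simp

section \<open>Bounding the optimal proper connection number\<close>

lemma pc_opt_le:
  assumes "properly_connected V E c"
  shows "pc_opt V E \<le> card (recolored E c) + card (c ` recolored E c)"
  unfolding pc_opt_def by (rule Least_le) (use assms in \<open>auto simp: pc_recoloring_def\<close>)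

text \<open>One way to spend a total of four: three edges and one new color.\<close>

lemma pc_opt_le_one_new_color:
  assumes "properly_connected V E (\<lambda>e. if e \<in> R then 2 else 1)" "finite R" "card R \<le> 3"
  shows "pc_opt V E \<le> 4"
proof -
  let ?c = "\<lambda>e. if e \<in> R then 2 else (1::nat)"
  have "recolored E ?c \<subseteq> R"
    by (auto simp: recolored_def)
  then have "card (recolored E ?c) \<le> 3"
    using assms(2,3) card_mono le_trans by blast
  moreover have "card (?c ` recolored E ?c) \<le> card {2::nat}"
    by (rule card_mono) (auto simp: recolored_def)
  then have "card (?c ` recolored E ?c) \<le> 1"
    by simp
  ultimately show ?thesis
    using pc_opt_le[OF assms(1)] by linarith
qed

text \<open>The other way: two edges, each with its own new color.\<close>

lemma pc_opt_le_two_new_colors: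
  assumes "properly_connected V E (\<lambda>e. if e = e1 then 2 else if e = e2 then 3 else 1)"
  shows "pc_opt V E \<le> 4"
proof -
  let ?c = "\<lambda>e. if e = e1 then 2 else if e = e2 then 3 else (1::nat)"
  have "recolored E ?c \<subseteq> {e1, e2}"
    by (auto simp: recolored_def)
  then have "card (recolored E ?c) \<le> card {e1, e2}"
    by (rule card_mono[rotated]) simp
  also have "\<dots> \<le> 2"
    by (simp add: card_insert_if)
  finally have "card (recolored E ?c) \<le> 2" .
  moreover have "card (?c ` recolored E ?c) \<le> card {2::nat, 3}"
    by (rule card_mono) (auto simp: recolored_def)
  then have "card (?c ` recolored E ?c) \<le> 2"
    by simp
  ultimately show ?thesis
    using pc_opt_le[OF assms] by linarith
qed

section \<open>Forbidden induced subgraphs of a counterexample\<close>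

text \<open>\<alpha> = 3 enters as the absence of independent 4-sets; the final contradiction is
  that independent 3-sets are absent as well.\<close>

locale counterexample =
  fixes V :: "'a set" and E :: "'a set set"
  assumes simple: "fin_simple_graph V E"
    and conn: "connected_graph V E"
    and indep4: "indep_set V E S \<Longrightarrow> card S \<noteq> 4"
    and large: "\<not> pc_opt V E \<le> 4"
begin

section \<open>Adjacency, and joining outside vertices through a colored subgraph\<close>

definition adj :: "'a \<Rightarrow> 'a \<Rightarrow> bool" where
  "adj u v \<longleftrightarrow> {u, v} \<in> E"

lemma adj_commute: "adj u v \<longleftrightarrow> adj v u"
  by (simp add: adj_def insert_commute)

lemma adjD: "adj u v \<Longrightarrow> u \<in> V \<and> v \<in> V \<and> u \<noteq> v"
  using simple by (fastforce simp: adj_def fin_simple_graph_def)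

lemma adj_irrefl [simp]: "\<not> adj u u"
  using adjD by blast

lemma no_indep4:
  assumes "distinct [p, q, r, s]" "{p, q, r, s} \<subseteq> V"
  shows "adj p q \<or> adj p r \<or> adj p s \<or> adj q r \<or> adj q s \<or> adj r s"
proof (rule ccontr)
  assume "\<not> ?thesis"
  then have "\<forall>x\<in>{p, q, r, s}. \<forall>y\<in>{p, q, r, s}. \<not> adj x y"
    by (auto simp: adj_commute)
  then have "indep_set V E {p, q, r, s}"
    using assms(2) by (simp add: indep_set_def adj_def)
  moreover have "card {p, q, r, s} = 4"
    using assms(1) by simp
  ultimately show False
    using indep4 by blast
qed

lemma crossing_edge:
  assumes "x \<in> V" "P x" "y \<in> V" "\<not> P y"
  obtains p q where "adj p q" "P p" "\<not> P q"
proof -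
  obtain xs where xs: "is_path V E x xs y"
    using conn assms by (auto simp: connected_graph_def)
  have "\<exists>p q. adj p q \<and> P p \<and> \<not> P q"
    if "xs \<noteq> []" "path_edges xs \<subseteq> E" "P (hd xs)" "\<not> P (last xs)" for xs
    using that
  proof (induction xs rule: induct_list012)
    case (3 a b xs)
    then show ?case
      by (cases "P b") (auto simp: path_edges_Cons_Cons adj_def)
  qed auto
  from this[of xs] show thesis
    using xs assms that unfolding is_path_def by auto
qed

text \<open>Edges from an outside vertex to \<open>H\<close> keep color \<open>1\<close>, so they can only be followed by walks in
  \<open>H\<close> that start with a new color.\<close>

definition reaches :: "('a set \<Rightarrow> nat) \<Rightarrow> 'a set \<Rightarrow> 'a \<Rightarrow> 'a \<Rightarrow> bool" where
  "reaches c H h k \<longleftrightarrow> h \<in> H \<and> (k = h \<or>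
     (\<exists>y ys. proper_walk E c (h # y # ys) \<and> distinct (h # y # ys) \<and> set (h # y # ys) \<subseteq> H \<and>
        c {h, y} \<noteq> 1 \<and> k \<in> set (y # ys)))"

text \<open>The walk is to be continued outside \<open>H\<close> at both ends, so both end edges
  need a new color. A single vertex does not qualify: two edges of color \<open>1\<close> would meet
  there.\<close>

definition linked :: "('a set \<Rightarrow> nat) \<Rightarrow> 'a set \<Rightarrow> 'a \<Rightarrow> 'a \<Rightarrow> bool" where
  "linked c H h k \<longleftrightarrow>
     (\<exists>xs. proper_walk E c xs \<and> distinct xs \<and> set xs \<subseteq> H \<and> 2 \<le> length xs \<and>
        hd xs = h \<and> last xs = k \<and>
        c {hd xs, hd (tl xs)} \<noteq> 1 \<and> c {last (butlast xs), last xs} \<noteq> 1)"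

lemma reachesI:
  assumes "proper_walk E c (h # y # ys)" "distinct (h # y # ys)" "set (h # y # ys) \<subseteq> H"
    "c {h, y} \<noteq> 1"
  shows "\<forall>k\<in>set (h # y # ys). reaches c H h k"
  using assms unfolding reaches_def by auto

lemma linkedI:
  assumes "proper_walk E c xs" "distinct xs" "set xs \<subseteq> H" "2 \<le> length xs"
    "c {hd xs, hd (tl xs)} \<noteq> 1" "c {last (butlast xs), last xs} \<noteq> 1"
  shows "linked c H (hd xs) (last xs)"
  using assms unfolding linked_def by blast

lemma joined_if_reaches:
  assumes "reaches c H h k" "adj u h" "u \<in> V - H" "H \<subseteq> V" "\<And>e. c e \<noteq> 1 \<Longrightarrow> e \<subseteq> H"
  shows "joined V E c u k"
proof (cases "k = h")
  case True
  then show ?thesis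
    using assms(2) adjD[of u h] by (intro joinedI[of E c "[u, h]"]) (auto simp: adj_def)
next
  case False
  then obtain y ys where ys: "proper_walk E c (h # y # ys)" "distinct (h # y # ys)"
      "set (h # y # ys) \<subseteq> H" "c {h, y} \<noteq> 1" "k \<in> set (y # ys)"
    using assms(1) unfolding reaches_def by auto
  moreover have "c {u, h} = 1"
    using assms(3,5) by blast
  ultimately show ?thesis
    using assms(2,3,4) by (intro joined_prefix[of E c u "h # y # ys"]) (auto simp: adj_def)
qed

lemma joined_if_linked:
  assumes "linked c H h k" "adj u h" "adj v k" "u \<in> V - H" "v \<in> V - H" "u \<noteq> v"
    "H \<subseteq> V" "\<And>e. c e \<noteq> 1 \<Longrightarrow> e \<subseteq> H"
  shows "joined V E c u v"
proof -
  obtain xs where xs: "proper_walk E c xs" "distinct xs" "set xs \<subseteq> H" "2 \<le> length xs"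
      "hd xs = h" "last xs = k" "c {hd xs, hd (tl xs)} \<noteq> 1" "c {last (butlast xs), last xs} \<noteq> 1"
    using assms(1) unfolding linked_def by blast
  have "c {u, h} = 1" "c {k, v} = 1"
    using assms(4,5,8) by blast+
  moreover have "proper_walk E c (xs @ [v])"
    using xs assms(3) \<open>c {k, v} = 1\<close>
    by (intro proper_walk_snoc) (auto simp: adj_def insert_commute)
  moreover obtain y ys where "xs = h # y # ys"
    using xs(4,5) by (metis One_nat_def Suc_1 Suc_le_length_iff list.sel(1))
  ultimately have "proper_walk E c (u # xs @ [v])"
    using xs(7) assms(2) by (simp add: adj_def)
  then show ?thesis
    using xs assms(4-7) by (intro joinedI[of E c "u # xs @ [v]"]) auto
qed

text \<open>\<open>walk\<close> settles pairs inside \<open>H\<close>, \<open>half\<close> mixed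
  pairs, \<open>outer\<close> nonadjacent outside pairs. \<open>outer\<close> is a refutation
  covering both orders of \<open>h\<close> and \<open>k\<close>, so instances become propositional
  and each link is needed in one direction only.\<close>

lemma properly_connected_via:
  assumes walk: "proper_walk E c xs" "distinct xs" "set xs = H" "H \<subseteq> V"
    and supp: "\<And>e. c e \<noteq> 1 \<Longrightarrow> e \<subseteq> H"
    and half: "\<And>u k. u \<in> V - H \<Longrightarrow> k \<in> H \<Longrightarrow> \<exists>h. adj u h \<and> reaches c H h k"
    and outer: "\<And>u v. u \<in> V - H \<Longrightarrow> v \<in> V - H \<Longrightarrow> u \<noteq> v \<Longrightarrow> \<not> adj u v \<Longrightarrow>
      (\<And>h k. linked c H h k \<Longrightarrow> \<not> (adj u h \<and> adj v k) \<and> \<not> (adj u k \<and> adj v h)) \<Longrightarrow> False"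
  shows "properly_connected V E c"
proof -
  have into: "joined V E c u k" if "u \<in> V - H" "k \<in> H" for u k
    using half[OF that] joined_if_reaches that(1) walk(4) supp by blast
  have "joined V E c u v" if "u \<in> V" "v \<in> V" "u \<noteq> v" for u v
  proof (cases "adj u v")
    case True
    then show ?thesis
      using that by (intro joinedI[of E c "[u, v]"]) (auto simp: adj_def)
  next
    case False
    consider "u \<in> H" "v \<in> H" | "u \<notin> H" "v \<in> H" | "u \<in> H" "v \<notin> H" | "u \<notin> H" "v \<notin> H"
      by blast
    then show ?thesis
    proof cases
      case 1
      then show ?thesis using joined_in_walk[OF walk(1,2), of V u v] walk(3,4) by simp
    next
      case 2
      then show ?thesis using into[of u v] that by simp
    next
      case 3
      then show ?thesis using into[of v u] that by (simp add: joined_sym)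
    next
      case 4
      then obtain h k where "adj u h \<and> adj v k \<or> adj u k \<and> adj v h" "linked c H h k"
        using outer[of u v] \<open>u \<in> V\<close> \<open>v \<in> V\<close> \<open>u \<noteq> v\<close> False by blast
      then show ?thesis
        using joined_if_linked[of c H h k u v] joined_if_linked[of c H h k v u]
          4 that walk(4) supp by (auto intro: joined_sym)
    qed
  qed
  then show ?thesis
    by (simp add: properly_connected_def joined_def)
qed

section \<open>Exclusions with one new color\<close>

definition two_coloring :: "'a set set \<Rightarrow> 'a set \<Rightarrow> nat" where
  "two_coloring R e = (if e \<in> R then 2 else 1)"

lemma two_coloring_impossible:
  assumes c: "c = two_coloring R" and H: "H = set xs"
    and R: "finite R" "card R \<le> 3" "\<Union>R \<subseteq> H"
    and walk: "proper_walk E c xs" "distinct xs" "H \<subseteq> V"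
    and half: "\<And>u k. u \<in> V - H \<Longrightarrow> k \<in> H \<Longrightarrow> \<exists>h. adj u h \<and> reaches c H h k"
    and outer: "\<And>u v. u \<in> V - H \<Longrightarrow> v \<in> V - H \<Longrightarrow> u \<noteq> v \<Longrightarrow> \<not> adj u v \<Longrightarrow>
      (\<And>h k. linked c H h k \<Longrightarrow> \<not> (adj u h \<and> adj v k) \<and> \<not> (adj u k \<and> adj v h)) \<Longrightarrow> False"
  shows False
proof -
  have "e \<subseteq> H" if "c e \<noteq> 1" for e
    using that R(3) by (auto simp: c two_coloring_def split: if_splits)
  then have "properly_connected V E c"
    using half outer by (intro properly_connected_via[OF walk(1,2) H[symmetric] walk(3)]) blast+
  moreover have "\<not> properly_connected V E c"
    using large pc_opt_le_one_new_color[of V E R] R(1,2) by (auto simp: c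
      two_coloring_def[abs_def])
  ultimately show False
    by simp
qed

lemmas walk_simps = insert_commute adj_def[symmetric] adj_commute

text \<open>Adjacency of \<open>p\<close> and \<open>w\<close> is left open: this excludes the 6-path and the 6-cycle at once.\<close>

lemma no_P6_C6:
  assumes dist: "distinct [p, q, r, s, t, w]"
    and edges: "adj p q" "adj q r" "adj r s" "adj s t" "adj t w"
    and nonedges: "\<not> adj p r" "\<not> adj p s" "\<not> adj p t" "\<not> adj q s" "\<not> adj q t" "\<not> adj q w"
      "\<not> adj r t" "\<not> adj r w" "\<not> adj s w"
  shows False
proof -
  define H where "H = set [p, q, r, s, t, w]"
  \<comment> \<open>Every second edge is recolored: the colors alternate along the path, with the
    new color at both ends.\<close>
  define c where "c = two_coloring {{p, q}, {r, s}, {t, w}}"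
  have HV: "H \<subseteq> V"
    using edges by (auto simp: H_def dest: adjD)
  have dist': "distinct [w, t, s, r, q, p]"
    using dist by auto
  have col: "c {p, q} = 2" "c {q, r} = 1" "c {r, s} = 2" "c {s, t} = 1" "c {t, w} = 2"
    "c {p, w} = 1"
    using dist dist' by (simp_all add: c_def two_coloring_def doubleton_eq_iff)
  have mem: "p \<in> H" "q \<in> H" "r \<in> H" "s \<in> H" "t \<in> H" "w \<in> H"
    by (auto simp: H_def)
  note simps = col mem walk_simps
  have links: "linked c H p q" "linked c H r s" "linked c H t w" "linked c H p s" "linked c H r w"
    "linked c H p w"
    using linkedI[of c "[p, q]" H] linkedI[of c "[r, s]" H] linkedI[of c "[t, w]" H]
      linkedI[of c "[p, q, r, s]" H] linkedI[of c "[r, s, t, w]" H]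
      linkedI[of c "[p, q, r, s, t, w]" H] dist dist' edges
    by (simp_all add: simps)
  have reach: "\<forall>k\<in>{p, q, r, s, t, w}. reaches c H p k" "\<forall>k\<in>{r, s, t, w}. reaches c H r k"
    "\<forall>k\<in>{w, t, s, r, q, p}. reaches c H w k" "\<forall>k\<in>{s, r, q, p}. reaches c H s k"
    using reachesI[of c p q "[r, s, t, w]" H] reachesI[of c r s "[t, w]" H]
      reachesI[of c w t "[s, r, q, p]" H] reachesI[of c s r "[q, p]" H]
      dist dist' edges
    by (simp_all add: simps)
  \<comment> \<open>The edge \<open>{p, w}\<close>, if present, has color \<open>1\<close>, so the
    colors alternate around the whole cycle.\<close>
  have cyc: "\<forall>k\<in>{r, s, t, w, p, q}. reaches c H r k" "\<forall>k\<in>{t, w, p, q, r, s}. reaches c H t k"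
    if "adj p w"
    using reachesI[of c r s "[t, w, p, q]" H] reachesI[of c t w "[p, q, r, s]" H]
      that dist dist' edges by (simp_all add: simps)
  \<comment> \<open>With \<open>links\<close>, these link each of \<open>p\<close>,
    \<open>r\<close>, \<open>t\<close> to each of \<open>q\<close>, \<open>s\<close>,
    \<open>w\<close>; every outside vertex sees (is adjacent to a member of) both triples.\<close>
  have cyc_links: "linked c H r q" "linked c H t s" "linked c H t q" if "adj p w"
    using linkedI[of c "[r, s, t, w, p, q]" H] linkedI[of c "[t, w, p, q, r, s]" H]
      linkedI[of c "[t, w, p, q]" H] that dist dist' edges by (simp_all add: simps)
  \<comment> \<open>Each triple is independent, the last two unless \<open>adj p w\<close>, so an
    outside vertex seeing none of it would complete an independent 4-set. \<open>dom2\<close>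
    applies this to two nonadjacent outside vertices and a nonadjacent pair.\<close>
  have dom: "adj u p \<or> adj u r \<or> adj u t" "adj u q \<or> adj u s \<or> adj u w"
    "adj p w \<or> adj u p \<or> adj u s \<or> adj u w" "adj p w \<or> adj u p \<or> adj u r \<or> adj u w"
    if "u \<in> V - H" for u
    using no_indep4[of u p r t] no_indep4[of u q s w] no_indep4[of u p s w] no_indep4[of u p r w]
      dist HV nonedges that by (auto simp: H_def)
  have dom2: "adj u p \<or> adj v p \<or> adj u r \<or> adj v r" "adj u s \<or> adj v s \<or> adj u w \<or> adj v w"
    if "u \<in> V - H" "v \<in> V - H" "u \<noteq> v" "\<not> adj u v" for u v
    using no_indep4[of u v p r] no_indep4[of u v s w] dist HV nonedges that by (auto simp: H_def)
  show False
  proof (rule two_coloring_impossible[OF c_def H_def])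
    fix u k
    assume u: "u \<in> V - H" and "k \<in> H"
    then have k: "k = p \<or> k = q \<or> k = r \<or> k = s \<or> k = t \<or> k = w"
      by (auto simp: H_def)
    show "\<exists>h. adj u h \<and> reaches c H h k"
    proof (cases "adj p w")
      case True
      then show ?thesis using dom(1)[OF u] reach(1) cyc k by auto
    next
      \<comment> \<open>A vertex seeing neither \<open>p\<close> nor \<open>w\<close> sees
        \<open>r\<close> and \<open>s\<close>, whose walks together cover \<open>H\<close>.\<close>
      case False
      then show ?thesis using dom[OF u] reach k by auto
    qed
  next
    fix u v
    assume uv: "u \<in> V - H" "v \<in> V - H" "u \<noteq> v" "\<not> adj u v"
      and no: "\<And>h k. linked c H h k \<Longrightarrow> \<not> (adj u h \<and> adj v k) \<and> \<not> (adj u k \<and> adj v h)"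
    show False
    proof (cases "adj p w")
      case True
      then show ?thesis
        using links[THEN no] cyc_links[THEN no] dom(1,2)[OF uv(1)] dom(1,2)[OF uv(2)] by argo
    next
      \<comment> \<open>\<open>p\<close> is linked to \<open>q\<close>, \<open>s\<close>,
        \<open>w\<close>, and \<open>w\<close> to \<open>p\<close>, \<open>r\<close>,
        \<open>t\<close>; by \<open>dom\<close> neither vertex can see \<open>p\<close> or
        \<open>w\<close>. Then both see \<open>r\<close> and \<open>s\<close>, which are
        linked.\<close>
      case False
      then show ?thesis
        using links[THEN no] dom[OF uv(1)] dom[OF uv(2)] dom2[OF uv] by argo
    qed
  next
    show "proper_walk E c [p, q, r, s, t, w]"
      using dist dist' edges by (simp add: simps)
  qed (use dist HV in \<open>auto simp: H_def card_insert_if\<close>)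
qed

text \<open>The same alternating path spans \<open>H\<close>; the remaining edge
  \<open>{q, w}\<close> has color \<open>1\<close>. Each of the independent vertices
  \<open>p\<close>, \<open>r\<close>, \<open>w\<close> starts an alternating walk through all of
  \<open>H\<close>.\<close>

lemma no_C5_pendant:
  assumes dist: "distinct [p, q, r, s, t, w]"
    and edges: "adj p q" "adj q r" "adj r s" "adj s t" "adj t w" "adj q w"
    and nonedges: "\<not> adj p r" "\<not> adj p s" "\<not> adj p t" "\<not> adj p w" "\<not> adj q s" "\<not> adj q t"
      "\<not> adj r t" "\<not> adj r w" "\<not> adj s w"
  shows False
proof -
  define H where "H = set [p, q, r, s, t, w]"
  define c where "c = two_coloring {{p, q}, {r, s}, {t, w}}"
  have HV: "H \<subseteq> V"
    using edges by (auto simp: H_def dest: adjD)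
  have dist': "distinct [w, t, s, r, q, p]"
    using dist by auto
  have col: "c {p, q} = 2" "c {q, r} = 1" "c {r, s} = 2" "c {s, t} = 1" "c {t, w} = 2"
    "c {q, w} = 1"
    using dist dist' by (simp_all add: c_def two_coloring_def doubleton_eq_iff)
  have mem: "p \<in> H" "q \<in> H" "r \<in> H" "s \<in> H" "t \<in> H" "w \<in> H"
    by (auto simp: H_def)
  note simps = col mem walk_simps
  have links: "linked c H r w" "linked c H p t" "linked c H w t" "linked c H r p"
    using linkedI[of c "[r, s, t, w]" H] linkedI[of c "[p, q, w, t]" H] linkedI[of c "[w, t]" H]
      linkedI[of c "[r, s, t, w, q, p]" H]
      dist dist' edges
    by (simp_all add: simps)
  have reach: "\<forall>k\<in>{p, q, r, s, t, w}. reaches c H p k" "\<forall>k\<in>{r, s, t, w, q, p}. reaches c H r k"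
    "\<forall>k\<in>{w, t, s, r, q, p}. reaches c H w k"
    using reachesI[of c p q "[r, s, t, w]" H] reachesI[of c r s "[t, w, q, p]" H]
      reachesI[of c w t "[s, r, q, p]" H]
      dist dist' edges
    by (simp_all add: simps)
  have dom: "adj u r \<or> adj u p \<or> adj u t" "adj u r \<or> adj u p \<or> adj u w"
    if "u \<in> V - H" for u
    using no_indep4[of u r p t] no_indep4[of u r p w] dist HV nonedges that
    by (auto simp: H_def adj_commute)
  have dom2: "adj u w \<or> adj v w \<or> adj u p \<or> adj v p" "adj u r \<or> adj v r \<or> adj u t \<or> adj v t"
    if "u \<in> V - H" "v \<in> V - H" "u \<noteq> v" "\<not> adj u v" for u v
    using no_indep4[of u v w p] no_indep4[of u v r t] dist HV nonedges that
    by (auto simp: H_def adj_commute)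
  show False
  proof (rule two_coloring_impossible[OF c_def H_def])
    fix u k
    assume u: "u \<in> V - H" and "k \<in> H"
    then have "k = p \<or> k = q \<or> k = r \<or> k = s \<or> k = t \<or> k = w"
      by (auto simp: H_def)
    then show "\<exists>h. adj u h \<and> reaches c H h k"
      using dom[OF u] reach by auto
  next
    fix u v
    assume uv: "u \<in> V - H" "v \<in> V - H" "u \<noteq> v" "\<not> adj u v"
      and no: "\<And>h k. linked c H h k \<Longrightarrow> \<not> (adj u h \<and> adj v k) \<and> \<not> (adj u k \<and> adj v h)"
    \<comment> \<open>If one vertex sees \<open>r\<close>, both see only \<open>r\<close> among
      \<open>p\<close>, \<open>r\<close>, \<open>w\<close>, so \<open>{p, w}\<close> is unseen,
      against \<open>dom2\<close>. Otherwise one sees \<open>t\<close>, and the other then sees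
      neither \<open>p\<close> nor \<open>w\<close>, against \<open>dom\<close>.\<close>
    show False
      using links[THEN no] dom[OF uv(1)] dom[OF uv(2)] dom2[OF uv] by argo
  next
    show "proper_walk E c [p, q, r, s, t, w]"
      using dist dist' edges by (simp add: simps)
  qed (use dist HV in \<open>auto simp: H_def card_insert_if\<close>)
qed

text \<open>Here the edge of color \<open>1\<close> off the spanning path is \<open>{r, w}\<close>.
  \<open>p\<close> and \<open>w\<close> start spanning alternating walks; two walks from
  \<open>s\<close>, via \<open>q\<close> and via \<open>w\<close>, together cover
  \<open>H\<close>.\<close>

lemma no_long_banner:
  assumes dist: "distinct [p, q, r, s, t, w]"
    and edges: "adj p q" "adj q r" "adj r s" "adj s t" "adj t w" "adj r w"
    and nonedges: "\<not> adj p r" "\<not> adj p s" "\<not> adj p t" "\<not> adj p w" "\<not> adj q s" "\<not> adj q t"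
      "\<not> adj q w" "\<not> adj r t" "\<not> adj s w"
  shows False
proof -
  define H where "H = set [p, q, r, s, t, w]"
  define c where "c = two_coloring {{p, q}, {r, s}, {t, w}}"
  have HV: "H \<subseteq> V"
    using edges by (auto simp: H_def dest: adjD)
  have dist': "distinct [w, t, s, r, q, p]"
    using dist by auto
  have col: "c {p, q} = 2" "c {q, r} = 1" "c {r, s} = 2" "c {s, t} = 1" "c {t, w} = 2"
    "c {r, w} = 1"
    using dist dist' by (simp_all add: c_def two_coloring_def doubleton_eq_iff)
  have mem: "p \<in> H" "q \<in> H" "r \<in> H" "s \<in> H" "t \<in> H" "w \<in> H"
    by (auto simp: H_def)
  note simps = col mem walk_simps
  have links: "linked c H w t" "linked c H s t" "linked c H w p" "linked c H s p"
    using linkedI[of c "[w, t]" H] linkedI[of c "[s, r, w, t]" H]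
      linkedI[of c "[w, t, s, r, q, p]" H] linkedI[of c "[s, r, q, p]" H]
      dist dist' edges
    by (simp_all add: simps)
  have reach: "\<forall>k\<in>{p, q, r, s, t, w}. reaches c H p k" "\<forall>k\<in>{w, t, s, r, q, p}. reaches c H w k"
    "\<forall>k\<in>{s, r, q, p}. reaches c H s k" "\<forall>k\<in>{s, r, w, t}. reaches c H s k"
    using reachesI[of c p q "[r, s, t, w]" H] reachesI[of c w t "[s, r, q, p]" H]
      reachesI[of c s r "[q, p]" H] reachesI[of c s r "[w, t]" H]
      dist dist' edges
    by (simp_all add: simps)
  have dom: "adj u w \<or> adj u s \<or> adj u p"
    if "u \<in> V - H" for u
    using no_indep4[of u w s p] dist HV nonedges that
    by (auto simp: H_def adj_commute)
  have dom2: "adj u w \<or> adj v w \<or> adj u s \<or> adj v s" "adj u p \<or> adj v p \<or> adj u t \<or> adj v t"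
    if "u \<in> V - H" "v \<in> V - H" "u \<noteq> v" "\<not> adj u v" for u v
    using no_indep4[of u v w s] no_indep4[of u v p t] dist HV nonedges that
    by (auto simp: H_def adj_commute)
  show False
  proof (rule two_coloring_impossible[OF c_def H_def])
    fix u k
    assume u: "u \<in> V - H" and "k \<in> H"
    then have "k = p \<or> k = q \<or> k = r \<or> k = s \<or> k = t \<or> k = w"
      by (auto simp: H_def)
    then show "\<exists>h. adj u h \<and> reaches c H h k"
      using dom[OF u] reach by auto
  next
    fix u v
    assume uv: "u \<in> V - H" "v \<in> V - H" "u \<noteq> v" "\<not> adj u v"
      and no: "\<And>h k. linked c H h k \<Longrightarrow> \<not> (adj u h \<and> adj v k) \<and> \<not> (adj u k \<and> adj v h)"
    \<comment> \<open>\<open>p\<close> is linked to \<open>s\<close> and \<open>w\<close>. So either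
      both vertices see \<open>p\<close> and neither sees \<open>s\<close> or \<open>w\<close>,
      against \<open>dom2\<close>, or neither sees \<open>p\<close>. Then one sees \<open>t\<close>,
      which is linked to \<open>s\<close> and \<open>w\<close>.\<close>
    show False
      using links[THEN no] dom[OF uv(1)] dom[OF uv(2)] dom2[OF uv] by argo
  next
    show "proper_walk E c [p, q, r, s, t, w]"
      using dist dist' edges by (simp add: simps)
  qed (use dist HV in \<open>auto simp: H_def card_insert_if\<close>)
qed

text \<open>Recoloring two opposite edges of the 4-cycle links each of \<open>q\<close>,
  \<open>s\<close> to each of \<open>r\<close>, \<open>t\<close>. By \<open>dom2\<close> both pairs
  are seen, and by \<open>pendant\<close> both outside vertices see the cycle, so a link
  applies.\<close>

lemma no_banner:
  assumes dist: "distinct [p, q, r, s, t]"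
    and edges: "adj p q" "adj q r" "adj r s" "adj s t" "adj q t"
    and nonedges: "\<not> adj p r" "\<not> adj p s" "\<not> adj p t" "\<not> adj q s" "\<not> adj r t"
  shows False
proof -
  define H where "H = set [r, s, t, q, p]"
  define c where "c = two_coloring {{q, t}, {r, s}}"
  have HV: "H \<subseteq> V"
    using edges by (auto simp: H_def dest: adjD)
  have dist': "distinct [t, s, r, q, p]"
    using dist by auto
  have col: "c {p, q} = 1" "c {q, r} = 1" "c {r, s} = 2" "c {s, t} = 1" "c {q, t} = 2"
    using dist dist' by (simp_all add: c_def two_coloring_def doubleton_eq_iff)
  have mem: "p \<in> H" "q \<in> H" "r \<in> H" "s \<in> H" "t \<in> H"
    by (auto simp: H_def)
  note simps = col mem walk_simps
  have links: "linked c H q t" "linked c H r s" "linked c H q r" "linked c H t s"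
    using linkedI[of c "[q, t]" H] linkedI[of c "[r, s]" H] linkedI[of c "[q, t, s, r]" H]
      linkedI[of c "[t, q, r, s]" H]
      dist dist' edges
    by (simp_all add: simps)
  have reach: "\<forall>k\<in>{r, s, t, q, p}. reaches c H r k" "\<forall>k\<in>{t, q, r, s}. reaches c H t k"
    "\<forall>k\<in>{t, q, p}. reaches c H t k" "\<forall>k\<in>{s, r, q, t}. reaches c H s k"
    "\<forall>k\<in>{q, t, s, r}. reaches c H q k"
    using reachesI[of c r s "[t, q, p]" H] reachesI[of c t q "[r, s]" H]
      reachesI[of c t q "[p]" H] reachesI[of c s r "[q, t]" H] reachesI[of c q t "[s, r]" H]
      dist dist' edges
    by (simp_all add: simps)
  \<comment> \<open>A vertex seeing only \<open>p\<close> would turn the pendant edge into a pendant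
    path of length two.\<close>
  have pendant: "adj u q \<or> adj u r \<or> adj u s \<or> adj u t" if "u \<in> V - H" for u
    using no_long_banner[of u p q r s t] no_indep4[of u p r t] dist HV edges nonedges that
    by (auto simp: H_def adj_commute)
  have self: "reaches c H p p"
    by (simp add: reaches_def mem)
  have dom: "adj u r \<or> adj u t \<or> adj u p"
    if "u \<in> V - H" for u
    using no_indep4[of u r t p] dist HV nonedges that
    by (auto simp: H_def adj_commute)
  have dom2: "adj u q \<or> adj v q \<or> adj u s \<or> adj v s" "adj u r \<or> adj v r \<or> adj u t \<or> adj v t"
    if "u \<in> V - H" "v \<in> V - H" "u \<noteq> v" "\<not> adj u v" for u v
    using no_indep4[of u v q s] no_indep4[of u v r t] dist HV nonedges that
    by (auto simp: H_def adj_commute)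
  show False
  proof (rule two_coloring_impossible[OF c_def H_def])
    fix u k
    assume u: "u \<in> V - H" and "k \<in> H"
    then have "k = p \<or> k = q \<or> k = r \<or> k = s \<or> k = t"
      by (auto simp: H_def)
    then show "\<exists>h. adj u h \<and> reaches c H h k"
      using dom[OF u] reach pendant[OF u] self by auto
  next
    fix u v
    assume uv: "u \<in> V - H" "v \<in> V - H" "u \<noteq> v" "\<not> adj u v"
      and no: "\<And>h k. linked c H h k \<Longrightarrow> \<not> (adj u h \<and> adj v k) \<and> \<not> (adj u k \<and> adj v h)"
    show False
      using links[THEN no] dom[OF uv(1)] dom[OF uv(2)] dom2[OF uv] pendant[OF uv(1)]
        pendant[OF uv(2)] by argo
  next
    show "proper_walk E c [r, s, t, q, p]"
      using dist dist' edges by (simp add: simps)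
  qed (use dist HV in \<open>auto simp: H_def card_insert_if\<close>)
qed

section \<open>Exclusions with two new colors\<close>

definition three_coloring :: "'a set \<Rightarrow> 'a set \<Rightarrow> 'a set \<Rightarrow> nat" where
  "three_coloring e1 e2 e = (if e = e1 then 2 else if e = e2 then 3 else 1)"

lemma not_properly_connected_three_coloring: "\<not> properly_connected V E (three_coloring e1 e2)"
  using large pc_opt_le_two_new_colors[of V E e1 e2] by (auto simp: three_coloring_def[abs_def])

text \<open>With new colors \<open>2\<close> and \<open>3\<close> on the two edges, a path through \<open>x\<close>, \<open>a\<close>, \<open>b\<close> joins any two
  outside vertices that have distinct neighbors among these three.\<close>

lemma no_cherry:
  assumes edges: "adj x a" "adj x b" and "a \<noteq> b"
    and dom: "\<And>u. u \<in> V - {x, a, b} \<Longrightarrow> adj u x \<or> adj u a \<or> adj u b"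
    and lonely: "\<And>u v h. u \<in> V - {x, a, b} \<Longrightarrow> v \<in> V - {x, a, b} \<Longrightarrow> u \<noteq> v \<Longrightarrow> \<not> adj u v \<Longrightarrow>
      h \<in> {x, a, b} \<Longrightarrow> \<forall>k\<in>{x, a, b}. (adj u k \<longleftrightarrow> k = h) \<and> (adj v k \<longleftrightarrow> k = h) \<Longrightarrow> False"
  shows False
proof -
  define H where "H = {x, a, b}"
  define c where "c = three_coloring {x, a} {x, b}"
  have dist: "distinct [x, a, b]" "distinct [b, a, x]"
    using edges \<open>a \<noteq> b\<close> by (auto dest: adjD)
  have HV: "H \<subseteq> V"
    using edges by (auto simp: H_def dest: adjD)
  have col: "c {x, a} = 2" "c {a, x} = 2" "c {x, b} = 3" "c {b, x} = 3"
    using dist by (simp_all add: c_def three_coloring_def doubleton_eq_iff)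
  have mem: "x \<in> H" "a \<in> H" "b \<in> H"
    by (auto simp: H_def)
  note simps = col mem adj_def[symmetric] adj_commute
  have links: "linked c H x a" "linked c H x b" "linked c H a b"
    using linkedI[of c "[x, a]" H] linkedI[of c "[x, b]" H] linkedI[of c "[a, x, b]" H] dist edges
    by (simp_all add: simps)
  have reach: "\<forall>k\<in>{a, x, b}. reaches c H a k" "\<forall>k\<in>{b, x, a}. reaches c H b k"
    "\<forall>k\<in>{x, a}. reaches c H x k" "\<forall>k\<in>{x, b}. reaches c H x k"
    using reachesI[of c a x "[b]" H] reachesI[of c b x "[a]" H] reachesI[of c x a "[]" H]
      reachesI[of c x b "[]" H] dist edges
    by (simp_all add: simps)
  have "properly_connected V E c"
  proof (rule properly_connected_via[of c "[a, x, b]" H])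
    fix u k
    assume u: "u \<in> V - H" and "k \<in> H"
    then have "k = x \<or> k = a \<or> k = b"
      by (auto simp: H_def)
    then show "\<exists>h. adj u h \<and> reaches c H h k"
      using dom[of u] u reach by (auto simp: H_def)
  next
    fix u v
    assume uv: "u \<in> V - H" "v \<in> V - H" "u \<noteq> v" "\<not> adj u v"
      and no: "\<And>h k. linked c H h k \<Longrightarrow> \<not> (adj u h \<and> adj v k) \<and> \<not> (adj u k \<and> adj v h)"
    show False
      using links[THEN no] dom[of u] dom[of v] lonely[of u v x] lonely[of u v a] lonely[of u v b]
        uv dist by (simp add: H_def) argo
  next
    show "proper_walk E c [a, x, b]"
      using dist edges by (simp add: simps)
    show "e \<subseteq> H" if "c e \<noteq> 1" for e
      using that by (auto simp: c_def three_coloring_def H_def split: if_splits)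
  qed (use dist HV in \<open>auto simp: H_def\<close>)
  then show False
    using not_properly_connected_three_coloring by (simp add: c_def)
qed

text \<open>For \<open>no_P5\<close>, when two outside vertices see only the same end of the cherry.
  Since \<open>r\<close>, \<open>t\<close>, \<open>u\<close>, \<open>v\<close> are not independent,
  \<open>t\<close> sees \<open>u\<close> or \<open>v\<close>: both give the 4-cycle
  \<open>t u q v\<close> with pendant \<open>s\<close>, just one gives a 5-cycle with a pendant edge
  at \<open>q\<close>.\<close>

lemma no_P4_twins:
  assumes dist: "distinct [q, r, s, t, u, v]"
    and edges: "adj q r" "adj r s" "adj s t" "adj q u" "adj q v"
    and nonedges: "\<not> adj q s" "\<not> adj q t" "\<not> adj r t"
      "\<not> adj r u" "\<not> adj r v" "\<not> adj s u" "\<not> adj s v" "\<not> adj u v"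
  shows False
proof -
  have "r \<in> V" "t \<in> V" "u \<in> V" "v \<in> V"
    using edges by (auto dest: adjD)
  then have "adj u t \<or> adj v t"
    using no_indep4[of r t u v] dist nonedges by (auto simp: adj_commute)
  then show False
    using no_banner[of s t u q v] no_C5_pendant[of v q r s t u] no_C5_pendant[of u q r s t v]
      dist edges nonedges by (auto simp: adj_commute)
qed

text \<open>The cherry is the middle \<open>q r s\<close>. A vertex not seeing it sees
  \<open>p\<close> or \<open>t\<close>, because \<open>p\<close>, \<open>r\<close>, \<open>t\<close>
  are independent, and so yields an induced 6-path or 6-cycle.\<close>

lemma no_P5:
  assumes dist: "distinct [p, q, r, s, t]"
    and edges: "adj p q" "adj q r" "adj r s" "adj s t"
    and nonedges: "\<not> adj p r" "\<not> adj p s" "\<not> adj p t" "\<not> adj q s" "\<not> adj q t" "\<not> adj r t"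
  shows False
proof -
  have V: "{p, q, r, s, t} \<subseteq> V"
    using edges by (auto dest: adjD)
  show False
  proof (rule no_cherry[of r q s])
    fix u assume "u \<in> V - {r, q, s}"
    then show "adj u r \<or> adj u q \<or> adj u s"
      using no_indep4[of u p r t] no_P6_C6[of u p q r s t] no_P6_C6[of u t s r q p]
        V dist edges nonedges
      by (cases "u = p"; cases "u = t") (auto simp: adj_commute)
  next
    fix u v h
    assume uv: "u \<in> V - {r, q, s}" "v \<in> V - {r, q, s}" "u \<noteq> v" "\<not> adj u v" and h: "h \<in> {r, q, s}"
      and *: "\<forall>k\<in>{r, q, s}. (adj u k \<longleftrightarrow> k = h) \<and> (adj v k \<longleftrightarrow> k = h)"
    consider "h = r" | "h = q" | "h = s"
      using h by blast
    then show False
    proof cases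
      case 1
      then show ?thesis
        using no_indep4[of q s u v] V dist edges nonedges uv *
        by (auto simp: adj_commute)
    next
      case 2
      then show ?thesis
        using no_P4_twins[of q r s t u v] V dist edges nonedges uv *
        by (auto simp: adj_commute)
    next
      case 3
      then show ?thesis
        using no_P4_twins[of s r q p u v] V dist edges nonedges uv *
        by (cases "p = u"; cases "p = v") (auto simp: adj_commute)
    qed
  qed (use edges dist in \<open>auto simp: adj_commute\<close>)
qed

text \<open>A vertex \<open>u\<close> not seeing the cherry sees \<open>d\<close>. Then
  \<open>e a x d u\<close> is an induced path, or, if \<open>adj u e\<close>,
  \<open>b x d u e\<close> is.\<close>

lemma no_fork:
  assumes dist: "distinct [x, a, b, d, e]"
    and edges: "adj x a" "adj x b" "adj x d" "adj a e"
    and nonedges: "\<not> adj a b" "\<not> adj a d" "\<not> adj b d" "\<not> adj x e" "\<not> adj b e" "\<not> adj d e"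
  shows False
proof -
  have V: "{x, a, b, d, e} \<subseteq> V"
    using edges by (auto dest: adjD)
  show False
  proof (rule no_cherry[of x a b])
    fix u assume "u \<in> V - {x, a, b}"
    then show "adj u x \<or> adj u a \<or> adj u b"
      using no_indep4[of u a b d] no_P5[of e a x d u] no_P5[of b x d u e]
        V dist edges nonedges
      by (auto simp: adj_commute)
  next
    fix u v h
    assume uv: "u \<in> V - {x, a, b}" "v \<in> V - {x, a, b}" "u \<noteq> v" "\<not> adj u v" and h: "h \<in> {x, a, b}"
      and *: "\<forall>k\<in>{x, a, b}. (adj u k \<longleftrightarrow> k = h) \<and> (adj v k \<longleftrightarrow> k = h)"
    consider "h = x" | "h = a" | "h = b"
      using h by blast
    then show False
    proof cases
      case 1
      then show ?thesis
        using no_indep4[of a b u v] V dist edges nonedges uv *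
        by (auto simp: adj_commute)
    next
      \<comment> \<open>\<open>d\<close> sees \<open>u\<close> or \<open>v\<close>, closing a
        4-cycle through \<open>x\<close> and \<open>a\<close> with pendant \<open>b\<close>.\<close>
      case 2
      then show ?thesis
        using no_indep4[of b d u v] no_banner[of b x a u d] no_banner[of b x a v d] V dist edges
          nonedges uv *
        by (auto simp: adj_commute)
    next
      \<comment> \<open>Without an induced 5-path both \<open>u\<close> and \<open>v\<close> see
        \<open>e\<close>, giving the 4-cycle \<open>b u e v\<close> with pendant
        \<open>x\<close>.\<close>
      case 3
      then show ?thesis
        using no_P5[of e a x b u] no_P5[of e a x b v] no_banner[of x b u e v] V dist edges
          nonedges uv *
        by (auto simp: adj_commute)
    qed
  qed (use edges dist in \<open>auto simp: adj_commute\<close>)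
qed

text \<open>A vertex not seeing the cherry sees \<open>d\<close> and extends the claw to a fork; a
  lonely pair at \<open>a\<close> or \<open>b\<close> gives a fork centered there.\<close>

lemma no_claw:
  assumes dist: "distinct [x, a, b, d]"
    and edges: "adj x a" "adj x b" "adj x d"
    and nonedges: "\<not> adj a b" "\<not> adj a d" "\<not> adj b d"
  shows False
proof -
  have V: "{x, a, b, d} \<subseteq> V"
    using edges by (auto dest: adjD)
  show False
  proof (rule no_cherry[of x a b])
    fix u assume "u \<in> V - {x, a, b}"
    then show "adj u x \<or> adj u a \<or> adj u b"
      using no_indep4[of u a b d] no_fork[of x d a b u]
        V dist edges nonedges
      by (auto simp: adj_commute)
  next
    fix u v h
    assume uv: "u \<in> V - {x, a, b}" "v \<in> V - {x, a, b}" "u \<noteq> v" "\<not> adj u v" and h: "h \<in> {x, a, b}"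
      and *: "\<forall>k\<in>{x, a, b}. (adj u k \<longleftrightarrow> k = h) \<and> (adj v k \<longleftrightarrow> k = h)"
    consider "h = x" | "h = a" | "h = b"
      using h by blast
    then show False
    proof cases
      case 1
      then show ?thesis
        using no_indep4[of a b u v] V dist edges nonedges uv *
        by (auto simp: adj_commute)
    next
      case 2
      then show ?thesis
        using no_fork[of a x u v b] V dist edges nonedges uv *
        by (auto simp: adj_commute)
    next
      case 3
      then show ?thesis
        using no_fork[of b x u v a] V dist edges nonedges uv *
        by (auto simp: adj_commute)
    qed
  qed (use edges dist in \<open>auto simp: adj_commute\<close>)
qed

text \<open>The cherry lies in the triangle. A vertex not seeing it sees \<open>p\<close> or
  \<open>q\<close> and gives an induced 5-path; a lonely pair gives a claw together with another
  triangle vertex.\<close>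

lemma no_bull:
  assumes dist: "distinct [x, y, z, p, q]"
    and edges: "adj x y" "adj y z" "adj x z" "adj p x" "adj q y"
    and nonedges: "\<not> adj p y" "\<not> adj p z" "\<not> adj q x" "\<not> adj q z" "\<not> adj p q"
  shows False
proof -
  have V: "{x, y, z, p, q} \<subseteq> V"
    using edges by (auto dest: adjD)
  show False
  proof (rule no_cherry[of x y z])
    fix u assume "u \<in> V - {x, y, z}"
    then show "adj u x \<or> adj u y \<or> adj u z"
      using no_indep4[of u p q z] no_P5[of u p x y q] no_P5[of u q y x p] no_P5[of p u q y z]
        V dist edges nonedges
      by (auto simp: adj_commute)
  next
    fix u v h
    assume uv: "u \<in> V - {x, y, z}" "v \<in> V - {x, y, z}" "u \<noteq> v" "\<not> adj u v" and h: "h \<in> {x, y, z}"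
      and *: "\<forall>k\<in>{x, y, z}. (adj u k \<longleftrightarrow> k = h) \<and> (adj v k \<longleftrightarrow> k = h)"
    consider "h = x" | "h = y" | "h = z"
      using h by blast
    then show False
    proof cases
      case 1
      then show ?thesis
        using no_claw[of x y u v] V dist edges nonedges uv *
        by (auto simp: adj_commute)
    next
      case 2
      then show ?thesis
        using no_claw[of y x u v] V dist edges nonedges uv *
        by (auto simp: adj_commute)
    next
      case 3
      then show ?thesis
        using no_claw[of z x u v] V dist edges nonedges uv *
        by (auto simp: adj_commute)
    qed
  qed (use edges dist in \<open>auto simp: adj_commute\<close>)
qed

section \<open>Graphs without induced claw, bull and 5-path\<close>

text \<open>Follow an edge from a vertex \<open>s\<close> not seeing the path to a vertex
  \<open>t\<close> seeing it. If \<open>t\<close> sees both ends, there is a claw at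
  \<open>t\<close>; only \<open>q\<close>, a claw at \<open>q\<close>; only one end, a 5-path;
  \<open>q\<close> and one end, a bull.\<close>

lemma no_P3_with_isolated:
  assumes "adj p q" "adj q y" "\<not> adj p y" "p \<noteq> y"
    and z: "z \<in> V" "z \<notin> {p, q, y}" "\<not> adj z p" "\<not> adj z q" "\<not> adj z y"
  shows False
proof -
  let ?far = "\<lambda>v. v \<notin> {p, q, y} \<and> \<not> adj v p \<and> \<not> adj v q \<and> \<not> adj v y"
  obtain s t where st: "adj s t" "?far s" "\<not> ?far t"
    using crossing_edge[of z ?far p] z assms adjD[of p q] by blast
  have dist: "distinct [p, q, y, s, t]" "distinct [t, s, y, q, p]"
    using st assms by (auto dest: adjD simp: adj_commute)
  have "adj t p \<or> adj t q \<or> adj t y"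
    using st assms(1,2) by (auto simp: adj_commute)
  then show False
    using no_claw[of t p y s] no_claw[of q p y t] no_P5[of s t p q y] no_P5[of s t y q p]
      no_bull[of t q p s y] no_bull[of t q y s p] st dist assms(1-4)
    by (auto simp: adj_commute)
qed

text \<open>Connectivity replaces \<open>x\<close> by a vertex \<open>p\<close>, still independent
  of \<open>y\<close> and \<open>z\<close>, with a neighbor \<open>q\<close> seeing one of them.
  Seeing both gives a claw at \<open>q\<close>; seeing one gives an induced path on three vertices
  that the other does not see.\<close>

lemma no_indep3:
  assumes "{x, y, z} \<subseteq> V" "distinct [x, y, z]"
    and "\<not> adj x y" "\<not> adj x z" "\<not> adj y z"
  shows False
proof -
  let ?far = "\<lambda>v. v \<noteq> y \<and> v \<noteq> z \<and> \<not> adj v y \<and> \<not> adj v z"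
  obtain p q where pq: "adj p q" "?far p" "\<not> ?far q"
    using crossing_edge[of x ?far y] assms by auto
  have "q \<noteq> y" "q \<noteq> z"
    using pq by auto
  then show False
    using pq no_claw[of q p y z] no_P3_with_isolated[of p q y z] no_P3_with_isolated[of p q z y]
      assms by (auto simp: adj_commute)
qed

end

section \<open>Contradiction for a graph with \<alpha> = 3\<close>

theorem theorem1p3:
  fixes V :: "'a set" and E :: "'a set set"
  assumes "fin_simple_graph V E"
    and "connected_graph V E"
    and "indep_number V E = 3"
  shows "pc_opt V E \<le> 4"
proof (rule ccontr)
  have fin: "finite {S. indep_set V E S}"
    using assms(1) by (auto simp: indep_set_def fin_simple_graph_def)
  have "{} \<in> {S. indep_set V E S}"
    by (simp add: indep_set_def)
  then have "indep_number V E \<in> card ` {S. indep_set V E S}"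
    unfolding indep_number_def using fin by (intro Max_in) auto
  then obtain S where S: "indep_set V E S" "card S = 3"
    using assms(3) by auto
  assume "\<not> pc_opt V E \<le> 4"
  moreover have "card T \<noteq> 4" if "indep_set V E T" for T
  proof -
    have "card T \<le> indep_number V E"
      unfolding indep_number_def using fin that by (intro Max_ge) auto
    then show ?thesis
      using assms(3) by simp
  qed
  ultimately interpret counterexample V E
    using assms(1,2) by unfold_locales
  obtain x y z where "S = {x, y, z}" "distinct [x, y, z]"
    using S(2) by (auto simp: card_3_iff)
  then show False
    using no_indep3[of x y z] S(1) by (auto simp: indep_set_def adj_def)
qed

end
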